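(* Let $k$ and $m$ be positive integers. Then the function $n \mapsto p(n,k)$ is periodic modulo $m$: there exists a positive integer $L$ such that $p(n,k) \equiv p(n+L,k) \pmod m$ for all nonnegative integers $n$.
   Context: For a nonnegative integer $n$ and a positive integer $k$, $p(n,k)$ denotes the number of partitions of $n$ into parts each less than or equal to $k$ (so $p(0,k)=1$); equivalently, $\sum_{n\ge 0} p(n,k)q^n = \prod_{i=1}^{k} \frac{1}{1-q^i}$. *)

theory Defs
  imports "HOL-Library.Multiset" "HOL-Number_Theory.Cong"
begin

text \<open>A partition is the multiset of its (positive) parts.\<close>

definition partitions_le :: "nat \<Rightarrow> nat \<Rightarrow> nat multiset set" where
  "partitions_le n k = {M. set_mset M \<subseteq> {1..k} \<and> sum_mset M = n}"

definition num_partitions_le :: "nat \<Rightarrow> nat \<Rightarrow> nat" where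
  "num_partitions_le n k = card (partitions_le n k)"

lemma size_le_sum_mset:
  assumes "set_mset M \<subseteq> {1..k::nat}"
  shows "size M \<le> sum_mset M"
  using assms by (induction M) auto

lemma finite_partitions_le: "finite (partitions_le n k)"
proof -
  have "partitions_le n k \<subseteq> mset ` {xs. set xs \<subseteq> {1..k} \<and> length xs \<le> n}"
  proof
    fix M assume "M \<in> partitions_le n k"
    then have M: "set_mset M \<subseteq> {1..k}" "size M \<le> n"
      using size_le_sum_mset by (auto simp: partitions_le_def)
    obtain xs where "M = mset xs" by (metis ex_mset)
    with M show "M \<in> mset ` {xs. set xs \<subseteq> {1..k} \<and> length xs \<le> n}" by auto
  qed
  moreover have "finite {xs. set xs \<subseteq> {1..k} \<and> length xs \<le> n}"
    by (rule finite_lists_length_le) simp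
  ultimately show ?thesis using finite_surj by blast
qed

lemma num_partitions_le_0: "num_partitions_le 0 k = 1"
proof -
  have "M = {#}" if "M \<in> partitions_le 0 k" for M
    using that size_le_sum_mset[of M k] by (simp add: partitions_le_def del: sum_mset_0_iff)
  then have "partitions_le 0 k = {{#}}" by (auto simp: partitions_le_def)
  then show ?thesis by (simp add: num_partitions_le_def)
qed

end

theory Submission
  imports Defs
begin

text \<open>
  Removing one part \<open>k + 1\<close> gives \<open>p(n + k + 1, k + 1) = p(n + k + 1, k) + p(n, k + 1)\<close>, so
  \<open>p(n + j (k + 1), k + 1) - p(n, k + 1)\<close> is a sum of \<open>j\<close> values of \<open>p(_, k)\<close>. If \<open>p(_, k)\<close> has
  period \<open>L\<close> modulo \<open>m\<close>, then for \<open>j = m L\<close> this sum consists of \<open>m\<close> congruent blocks and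
  vanishes modulo \<open>m\<close>; hence \<open>m L (k + 1)\<close> is a period of \<open>p(_, k + 1)\<close>. The induction starts at
  \<open>k = 1\<close>, since \<open>p(_, 0)\<close> is not periodic.
\<close>

text \<open>The split is by whether \<open>Suc k\<close> occurs as a part; writing the total as
  \<open>n + Suc k\<close> avoids subtraction.\<close>

lemma partitions_le_Suc:
  "partitions_le (n + Suc k) (Suc k) =
     partitions_le (n + Suc k) k \<union> add_mset (Suc k) ` partitions_le n (Suc k)"
proof (intro equalityI subsetI)
  fix M assume M: "M \<in> partitions_le (n + Suc k) (Suc k)"
  show "M \<in> partitions_le (n + Suc k) k \<union> add_mset (Suc k) ` partitions_le n (Suc k)"
  proof (cases "Suc k \<in># M")
    case True
    then obtain N where "M = add_mset (Suc k) N"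
      by (metis mset_add)
    with M show ?thesis
      by (auto simp: partitions_le_def)
  next
    case False
    have "{1..Suc k} = insert (Suc k) {1..k}"
      by auto
    with False M have "set_mset M \<subseteq> {1..k}"
      by (auto simp: partitions_le_def subset_insert)
    with M show ?thesis
      by (simp add: partitions_le_def)
  qed
qed (auto simp: partitions_le_def)

lemma num_partitions_le_Suc:
  "num_partitions_le (n + Suc k) (Suc k) =
     num_partitions_le (n + Suc k) k + num_partitions_le n (Suc k)"
proof -
  have "partitions_le (n + Suc k) k \<inter> add_mset (Suc k) ` partitions_le n (Suc k) = {}"
    by (auto simp: partitions_le_def)
  then have "card (partitions_le (n + Suc k) (Suc k)) =
      card (partitions_le (n + Suc k) k) + card (add_mset (Suc k) ` partitions_le n (Suc k))"
    unfolding partitions_le_Suc by (intro card_Un_disjoint) (auto simp: finite_partitions_le)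
  then show ?thesis
    by (simp add: num_partitions_le_def card_image inj_on_def)
qed

text \<open>Iterates the recurrence \<open>j\<close> times. The index is \<open>Suc i\<close>
  because each step counts partitions without the part \<open>Suc k\<close> at its larger
  argument.\<close>

lemma num_partitions_le_add_mult:
  "num_partitions_le (n + j * Suc k) (Suc k) =
     num_partitions_le n (Suc k) + (\<Sum>i<j. num_partitions_le (n + Suc i * Suc k) k)"
proof (induction j)
  case (Suc j)
  have "n + Suc j * Suc k = (n + j * Suc k) + Suc k"
    by simp
  then show ?case
    unfolding sum.lessThan_Suc using num_partitions_le_Suc[of "n + j * Suc k" k] Suc by presburger
qed simp

lemma num_partitions_le_Suc_0: "num_partitions_le n (Suc 0) = 1"
proof (induction n)
  case (Suc n)
  \<comment> \<open>With no parts allowed, a positive number has no partition, so the recurrence for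
    \<open>k = 0\<close> makes the count constant.\<close>
  have "partitions_le (Suc n) 0 = {}"
    by (auto simp: partitions_le_def)
  then show ?case
    using num_partitions_le_Suc[of n 0] Suc by (simp add: num_partitions_le_def)
qed (simp add: num_partitions_le_0)

lemma cong_add_mult_period:
  fixes h :: "nat \<Rightarrow> 'a::unique_euclidean_semiring"
  assumes "\<And>i. [h (i + L) = h i] (mod m)"
  shows "[h (i + t * L) = h i] (mod m)"
proof (induction t)
  case (Suc t)
  have "[h (i + t * L + L) = h (i + t * L)] (mod m)"
    by (rule assms)
  then have "[h (i + t * L + L) = h i] (mod m)"
    using Suc by (rule cong_trans)
  then show ?case
    by (simp add: ac_simps)
qed simp

text \<open>Cut the range into \<open>t\<close> blocks of length \<open>L\<close>; each is termwise
  congruent to the first.\<close>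

lemma cong_sum_periods:
  fixes h :: "nat \<Rightarrow> 'a::unique_euclidean_semiring"
  assumes "\<And>i. [h (i + L) = h i] (mod m)"
  shows "[(\<Sum>i<t * L. h i) = of_nat t * (\<Sum>i<L. h i)] (mod m)"
proof -
  have "(\<Sum>i<t * L. h i) = (\<Sum>s<t. \<Sum>i<L. h (i + s * L))"
    unfolding sum.nat_group[symmetric]
  proof (rule sum.cong)
    fix s
    show "sum h {s * L..<s * L + L} = (\<Sum>i<L. h (i + s * L))"
      using sum.shift_bounds_nat_ivl[of h 0 "s * L" L] by (simp add: add.commute atLeast0LessThan)
  qed simp
  also have "[\<dots> = (\<Sum>s<t. \<Sum>i<L. h i)] (mod m)"
    by (intro cong_sum cong_add_mult_period assms)
  finally show ?thesis
    by simp
qed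

theorem theorem1p1:
  fixes k m :: nat
  assumes "k > 0" and "m > 0"
  shows "\<exists>L>0. \<forall>n. [num_partitions_le n k = num_partitions_le (n + L) k] (mod m)"
  using \<open>k > 0\<close>
proof (induction k rule: nat_induct_non_zero)
  case 1
  show ?case
    by (rule exI[of _ 1]) (simp add: num_partitions_le_Suc_0)
next
  case (Suc k)
  then obtain L where "L > 0"
    and L: "\<And>n. [num_partitions_le (n + L) k = num_partitions_le n k] (mod m)"
    using cong_sym by blast
  have "[num_partitions_le n (Suc k) = num_partitions_le (n + m * L * Suc k) (Suc k)] (mod m)" for n
  proof -
    define h where "h i = num_partitions_le (n + Suc i * Suc k) k" for i
    \<comment> \<open>Moving \<open>i\<close> by \<open>L\<close> moves the argument by
      \<open>L * Suc k\<close>, which is \<open>Suc k\<close> full periods.\<close>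
    have "[h (i + L) = h i] (mod m)" for i
      using cong_add_mult_period[where h = "\<lambda>n. num_partitions_le n k", OF L,
          of "n + Suc i * Suc k" "Suc k"]
      by (simp add: h_def algebra_simps)
    then have "[(\<Sum>i<m * L. h i) = m * (\<Sum>i<L. h i)] (mod m)"
      using cong_sum_periods[of h L m m] by simp
    then have "[(\<Sum>i<m * L. h i) = 0] (mod m)"
      by (simp add: cong_def)
    then have "[num_partitions_le n (Suc k) + (\<Sum>i<m * L. h i) = num_partitions_le n (Suc k) + 0]
        (mod m)"
      by (intro cong_add cong_refl)
    then show ?thesis
      using num_partitions_le_add_mult[of n "m * L" k]
      unfolding h_def by (metis add_0_right cong_sym)
  qed
  then show ?case
    using \<open>L > 0\<close> \<open>m > 0\<close> by (intro exI[of _ "m * L * Suc k"]) simp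
qed

end
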